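(* Let $\lambda_1,\kappa_1,\lambda_2,\kappa_2\in\mathbb{F}_q((T^{-1}))$, let $L_j(\underline{P}) := \lambda_j P_1 + \kappa_j P_2$ for $j=1,2$ and $\underline{P}=(P_1,P_2)$, and suppose $\Delta := |\lambda_1\kappa_2 - \lambda_2\kappa_1| > 0$. (1) For all $\rho_1,\rho_2 \in \mathbb{F}_q((T^{-1}))$ there exists $\underline{Q}\in\mathbb{F}_q[T]^2$ such that \[ |L_1(\underline{Q}) + \rho_1|\,|L_2(\underline{Q}) + \rho_2| \leq q^{-2}\Delta. \] (2) If moreover $\kappa_1\lambda_1^{-1} \notin \mathbb{F}_q(T)$ and $k\in\mathbb{N}$, then there exists such a $\underline{Q}$ which in addition satisfies \[ \deg\big(L_1(\underline{Q}) + \rho_1\big) < -k. \]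
   Context: $\mathbb{F}_q((T^{-1}))$ is the field of formal Laurent series in $T^{-1}$ over the finite field $\mathbb{F}_q$; for nonzero $x$, $\deg x$ is the largest $n$ with nonzero coefficient of $T^n$ and $|x|=q^{\deg x}$; $|0|=0$ and $\deg 0=-\infty$. *)

theory Defs
  imports
    "HOL-Computational_Algebra.Formal_Laurent_Series"
    "HOL-Computational_Algebra.Polynomial"
    "HOL-Library.Extended_Real"
    "HOL-Library.Cardinality"
begin

text \<open>
  The field of formal Laurent series in \<open>1/T\<close> over the finite field \<open>'a\<close> is the type
  \<open>'a fls\<close> with its indeterminate \<open>fls_X\<close> read as \<open>1/T\<close>. Hence \<open>T\<close> is \<open>fls_X_inv\<close>, the
  coefficient of \<open>T^n\<close> in \<open>x\<close> is \<open>fls_nth x (-n)\<close>, and the largest \<open>n\<close> for which it is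
  nonzero is \<open>- fls_subdegree x\<close>.
\<close>

definition laurent_deg :: "'a::zero fls \<Rightarrow> ereal" where
  "laurent_deg x = (if x = 0 then - \<infinity> else ereal (of_int (- fls_subdegree x)))"

definition laurent_abs :: "'a::{zero,finite} fls \<Rightarrow> real" where
  "laurent_abs x = (if x = 0 then 0 else real CARD('a) powi (- fls_subdegree x))"

definition fls_of_poly_T :: "'a::comm_ring_1 poly \<Rightarrow> 'a fls" where
  "fls_of_poly_T P = poly (map_poly fls_const P) fls_X_inv"

definition rational_functions_T :: "'a::field fls set" where
  "rational_functions_T = {fls_of_poly_T A / fls_of_poly_T B | A B. B \<noteq> 0}"

definition linear_form_T :: "'a::comm_ring_1 fls \<Rightarrow> 'a fls \<Rightarrow> 'a poly \<times> 'a poly \<Rightarrow> 'a fls" where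
  "linear_form_T l k P = l * fls_of_poly_T (fst P) + k * fls_of_poly_T (snd P)"

end

theory Submission
  imports Defs
begin

text \<open>
  Let \<open>M\<close> be the set of all \<open>(L\<^sub>1(P), L\<^sub>2(P))\<close>. Suppose that \<open>(x, y), (z, t) \<in> M\<close> have a determinant
  of absolute value \<open>\<Delta>\<close> and satisfy \<open>|z| < |x|\<close> and \<open>|y| \<le> |t|\<close>. Then \<open>|x| |t| = \<Delta>\<close>, and subtracting the
  polynomial parts of the coordinates of \<open>(\<rho>\<^sub>1, \<rho>\<^sub>2)\<close> with respect to this basis leaves a vector whose
  components have absolute values at most \<open>|x|/q\<close> and \<open>|t|/q\<close>; this gives the bound \<open>q\<^sup>-\<^sup>2 \<Delta>\<close>. Such pairs
  are produced by the Euclidean algorithm applied to the first components. Once \<open>|y| \<le> |t|\<close> holds it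
  persists, and before that \<open>|x| |y|\<close> exceeds \<open>\<Delta>\<close> and decreases in each step. If the algorithm never
  stops, \<open>|x|\<close> becomes arbitrarily small; it stops only at a nonzero \<open>P\<close> with \<open>L\<^sub>1(P) = 0\<close>, which makes
  \<open>\<kappa>\<^sub>1/\<lambda>\<^sub>1\<close> rational.
\<close>

section \<open>The ultrametric absolute value and its discreteness\<close>

lemma two_le_card_field: "(2::nat) \<le> CARD('a::{field,finite})"
proof -
  have "card {0, 1 :: 'a} \<le> CARD('a)"
    by (rule card_mono) auto
  then show ?thesis
    by simp
qed

lemma card_powi_less_iff [simp]:
  "real CARD('a::{field,finite}) powi m < real CARD('a) powi n \<longleftrightarrow> m < n"
proof -
  have q: "1 < real CARD('a)"
    using two_le_card_field[where 'a = 'a] by simp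
  show ?thesis
    using power_int_strict_increasing[OF _ q, of m n] power_int_strict_increasing[OF _ q, of n m]
    by (cases m n rule: linorder_cases) auto
qed

lemma card_powi_le_iff [simp]:
  "real CARD('a::{field,finite}) powi m \<le> real CARD('a) powi n \<longleftrightarrow> m \<le> n"
  using card_powi_less_iff[where 'a = 'a, of n m] by linarith

lemma laurent_abs_0 [simp]: "laurent_abs (0 :: 'a::{field,finite} fls) = 0"
  by (simp add: laurent_abs_def)

lemma laurent_abs_nonneg [simp]: "0 \<le> laurent_abs (x :: 'a::{field,finite} fls)"
  by (simp add: laurent_abs_def)

lemma laurent_abs_pos_iff [simp]:
  "0 < laurent_abs (x :: 'a::{field,finite} fls) \<longleftrightarrow> x \<noteq> 0"
  using two_le_card_field[where 'a = 'a] by (simp add: laurent_abs_def)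

lemma laurent_abs_le_0_iff [simp]:
  "laurent_abs (x :: 'a::{field,finite} fls) \<le> 0 \<longleftrightarrow> x = 0"
  using laurent_abs_pos_iff[of x] by (simp only: flip: not_less) simp

lemma laurent_abs_minus [simp]:
  "laurent_abs (- x :: 'a::{field,finite} fls) = laurent_abs x"
  by (simp add: laurent_abs_def)

lemma laurent_abs_mult:
  "laurent_abs (x * y :: 'a::{field,finite} fls) = laurent_abs x * laurent_abs y"
  using two_le_card_field[where 'a = 'a]
  by (auto simp: laurent_abs_def fls_subdegree_mult simp flip: power_int_add)

lemma laurent_abs_le_powi_iff:
  "x \<noteq> 0 \<Longrightarrow> laurent_abs (x :: 'a::{field,finite} fls) \<le> real CARD('a) powi n \<longleftrightarrow> - n \<le> fls_subdegree x"
  by (auto simp: laurent_abs_def)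

lemma laurent_abs_add_le:
  "laurent_abs (x + y :: 'a::{field,finite} fls) \<le> max (laurent_abs x) (laurent_abs y)"
proof (cases "x = 0 \<or> y = 0 \<or> x + y = 0")
  case True
  then show ?thesis
    by (auto simp: le_max_iff_disj)
next
  case False
  then have "min (fls_subdegree x) (fls_subdegree y) \<le> fls_subdegree (x + y)"
    by (intro fls_plus_subdegree) auto
  with False show ?thesis
    by (simp add: laurent_abs_def le_max_iff_disj min_le_iff_disj disj_commute)
qed

lemma laurent_abs_diff_le:
  "laurent_abs (x - y :: 'a::{field,finite} fls) \<le> max (laurent_abs x) (laurent_abs y)"
  using laurent_abs_add_le[of x "- y"] by simp

text \<open>In \<open>x = (x - y) + y\<close> the term \<open>y\<close> is too small to attain the
  maximum, so \<open>x - y\<close> must.\<close>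

lemma laurent_abs_diff_eq_left:
  fixes x y :: "'a::{field,finite} fls"
  assumes "laurent_abs y < laurent_abs x"
  shows "laurent_abs (x - y) = laurent_abs x"
  using laurent_abs_diff_le[of x y] laurent_abs_add_le[of "x - y" y] assms by simp

text \<open>Nonzero values are integer powers of q, so a strict inequality gains a whole factor q.
  This turns each Euclidean step into a decrease of an exponent, which induction can count.\<close>

lemma laurent_abs_discrete:
  fixes x y :: "'a::{field,finite} fls"
  assumes "laurent_abs x < laurent_abs y"
  shows "real CARD('a) * laurent_abs x \<le> laurent_abs y"
proof (cases "x = 0")
  case False
  have q: "1 < real CARD('a)"
    using two_le_card_field[where 'a = 'a] by simp
  have "0 < laurent_abs y"
    using laurent_abs_nonneg assms by (rule le_less_trans)
  then have "y \<noteq> 0"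
    by simp
  with False assms have "fls_subdegree y < fls_subdegree x"
    by (simp add: laurent_abs_def)
  then have "real CARD('a) powi (1 + - fls_subdegree x) \<le> real CARD('a) powi (- fls_subdegree y)"
    by (subst card_powi_le_iff) auto
  then have "real CARD('a) * real CARD('a) powi (- fls_subdegree x) \<le> real CARD('a) powi (- fls_subdegree y)"
    using q by (subst (asm) power_int_add) auto
  with False \<open>y \<noteq> 0\<close> show ?thesis
    by (simp add: laurent_abs_def)
qed simp

lemma laurent_deg_less_if_laurent_abs_less:
  fixes x :: "'a::{field,finite} fls"
  assumes "laurent_abs x < real CARD('a) powi (- int k)"
  shows "laurent_deg x < - ereal (real k)"
proof (cases "x = 0")
  case False
  have "- fls_subdegree x < - int k"
    using assms False by (simp add: laurent_abs_def)
  then have "real k < real_of_int (fls_subdegree x)"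
    by linarith
  with False show ?thesis
    by (simp add: laurent_deg_def)
qed (simp add: laurent_deg_def)

section \<open>Polynomials in T as Laurent series\<close>

lemma fls_of_poly_T_0 [simp]: "fls_of_poly_T 0 = 0"
  by (simp add: fls_of_poly_T_def)

lemma fls_of_poly_T_pCons:
  "fls_of_poly_T (pCons a p) = fls_const a + fls_X_inv * fls_of_poly_T p"
  by (simp add: fls_of_poly_T_def map_poly_pCons)

lemma fls_of_poly_T_1 [simp]: "fls_of_poly_T 1 = 1"
  by (simp add: one_pCons fls_of_poly_T_pCons)

lemma fls_nth_fls_of_poly_T:
  "fls_nth (fls_of_poly_T p) n = (if n \<le> 0 then coeff p (nat (- n)) else 0)"
proof (induction p arbitrary: n)
  case (pCons a p)
  show ?case
  proof (cases "n = 0")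
    case False
    have "nat (- n) = Suc (nat (- (n + 1)))" if "n < 0"
      using that by simp
    with False show ?thesis
      by (auto simp: fls_of_poly_T_pCons fls_X_inv_times_conv_shift pCons.IH)
  qed (simp add: fls_of_poly_T_pCons fls_X_inv_times_conv_shift pCons.IH)
qed simp

lemma fls_of_poly_T_add: "fls_of_poly_T (p + q) = fls_of_poly_T p + fls_of_poly_T q"
  by (rule fls_eqI) (simp add: fls_nth_fls_of_poly_T)

lemma fls_of_poly_T_uminus: "fls_of_poly_T (- p) = - fls_of_poly_T p"
  by (rule fls_eqI) (simp add: fls_nth_fls_of_poly_T)

lemma fls_of_poly_T_diff: "fls_of_poly_T (p - q) = fls_of_poly_T p - fls_of_poly_T q"
  by (rule fls_eqI) (simp add: fls_nth_fls_of_poly_T)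

lemma fls_of_poly_T_smult: "fls_of_poly_T (smult a p) = fls_const a * fls_of_poly_T p"
  by (rule fls_eqI) (simp add: fls_nth_fls_of_poly_T)

lemma fls_of_poly_T_mult: "fls_of_poly_T (p * q) = fls_of_poly_T p * fls_of_poly_T q"
  by (induction p)
    (simp_all add: fls_of_poly_T_add fls_of_poly_T_smult fls_of_poly_T_pCons algebra_simps)

lemma fls_of_poly_T_eq_0_iff [simp]: "fls_of_poly_T p = 0 \<longleftrightarrow> p = 0"
proof
  assume *: "fls_of_poly_T p = 0"
  show "p = 0"
  proof (rule poly_eqI)
    fix n
    show "coeff p n = coeff 0 n"
      using fls_nth_fls_of_poly_T[of p "- int n"] * by simp
  qed
qed simp

section \<open>Polynomial part and division with remainder\<close>

lemma ex_poly_part: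
  fixes x :: "'a::{field,finite} fls"
  obtains c where "laurent_abs (x - fls_of_poly_T c) \<le> 1 / real CARD('a)"
proof -
  \<comment> \<open>\<open>fls_prpart\<close> keeps only the positive powers of T, so the constant
    term is added separately; the remainder then starts at the power -1 of T.\<close>
  define c where "c = fls_prpart x + [:fls_nth x 0:]"
  have nth: "fls_nth (x - fls_of_poly_T c) n = 0" if "n < 1" for n
    using that by (cases "n = 0") (auto simp: c_def fls_nth_fls_of_poly_T coeff_pCons split: nat.split)
  have "laurent_abs (x - fls_of_poly_T c) \<le> real CARD('a) powi (- 1)"
  proof (cases "x - fls_of_poly_T c = 0")
    case False
    then have "1 \<le> fls_subdegree (x - fls_of_poly_T c)"
      using nth nth_fls_subdegree_nonzero not_le_imp_less by blast
    with False show ?thesis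
      by (subst laurent_abs_le_powi_iff) auto
  qed simp
  then show ?thesis
    by (intro that) (simp add: power_int_minus divide_inverse)
qed

text \<open>The polynomial part of \<open>x / z\<close> serves as quotient: its error is below 1,
  and multiplying by \<open>z\<close> scales it.\<close>

lemma ex_poly_quotient:
  fixes x z :: "'a::{field,finite} fls"
  assumes "z \<noteq> 0"
  obtains c where "laurent_abs (x - fls_of_poly_T c * z) < laurent_abs z"
proof -
  obtain c where c: "laurent_abs (x / z - fls_of_poly_T c) \<le> 1 / real CARD('a)"
    by (rule ex_poly_part)
  have "1 / real CARD('a) < 1"
    using two_le_card_field[where 'a = 'a] by simp
  then have "laurent_abs (x / z - fls_of_poly_T c) * laurent_abs z < 1 * laurent_abs z"
    using assms by (intro mult_strict_right_mono le_less_trans[OF c]) auto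
  moreover have "(x / z - fls_of_poly_T c) * z = x - fls_of_poly_T c * z"
    using assms by (simp add: algebra_simps)
  ultimately show ?thesis
    by (intro that) (simp flip: laurent_abs_mult)
qed

section \<open>The Euclidean algorithm on pairs of vectors\<close>

text \<open>For nonempty \<open>M\<close> this one closure property amounts to being a submodule
  over the polynomials: \<open>v - v\<close> gives 0, and negating \<open>c\<close> gives multiples
  and sums. It is also exactly the operation of a Euclidean step.\<close>

definition poly_submodule :: "('a::comm_ring_1 fls \<times> 'a fls) set \<Rightarrow> bool" where
  "poly_submodule M \<longleftrightarrow> (\<forall>x y z t c. (x, y) \<in> M \<longrightarrow> (z, t) \<in> M \<longrightarrow>
     (x - fls_of_poly_T c * z, y - fls_of_poly_T c * t) \<in> M)"

lemma poly_submoduleD: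
  "poly_submodule M \<Longrightarrow> (x, y) \<in> M \<Longrightarrow> (z, t) \<in> M \<Longrightarrow>
   (x - fls_of_poly_T c * z, y - fls_of_poly_T c * t) \<in> M"
  by (simp add: poly_submodule_def)

text \<open>The invariant of the algorithm: \<open>x\<close> and \<open>z\<close> are consecutive
  remainders, and \<open>y\<close> and \<open>t\<close> are the second components carried
  along.\<close>

definition euclid_pair ::
  "('a::{field,finite} fls \<times> 'a fls) set \<Rightarrow> real \<Rightarrow> 'a fls \<Rightarrow> 'a fls \<Rightarrow> 'a fls \<Rightarrow> 'a fls \<Rightarrow> bool" where
  "euclid_pair M d x y z t \<longleftrightarrow> (x, y) \<in> M \<and> (z, t) \<in> M \<and> laurent_abs (x * t - y * z) = d \<and>
     laurent_abs z < laurent_abs x"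

text \<open>Subtracting a multiple of one vector preserves the determinant, and swapping the two
  only changes its sign.\<close>

lemma euclid_pair_step:
  fixes x y z t :: "'a::{field,finite} fls"
  assumes M: "poly_submodule M" and p: "euclid_pair M d x y z t" and z: "z \<noteq> 0"
  obtains c where "euclid_pair M d z t (x - fls_of_poly_T c * z) (y - fls_of_poly_T c * t)"
proof -
  obtain c where c: "laurent_abs (x - fls_of_poly_T c * z) < laurent_abs z"
    using z by (rule ex_poly_quotient)
  have "z * (y - fls_of_poly_T c * t) - t * (x - fls_of_poly_T c * z) = - (x * t - y * z)"
    by (simp add: algebra_simps)
  then have "laurent_abs (z * (y - fls_of_poly_T c * t) - t * (x - fls_of_poly_T c * z)) = d"
    using p by (simp only: laurent_abs_minus euclid_pair_def)
  with c p M show ?thesis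
    by (intro that[of c]) (auto simp: euclid_pair_def intro: poly_submoduleD)
qed

lemma euclid_pair_ordered_step:
  fixes x y z t :: "'a::{field,finite} fls"
  assumes M: "poly_submodule M" and p: "euclid_pair M d x y z t" and z: "z \<noteq> 0"
    and yt: "laurent_abs y \<le> laurent_abs t" and d: "d > 0"
  obtains z' t' where "euclid_pair M d z t z' t'" "laurent_abs t \<le> laurent_abs t'"
proof -
  obtain c where c: "euclid_pair M d z t (x - fls_of_poly_T c * z) (y - fls_of_poly_T c * t)"
    using M p z by (rule euclid_pair_step)
  let ?c = "fls_of_poly_T c"
  have t: "0 < laurent_abs t"
    using p d yt by (cases "t = 0") (auto simp: euclid_pair_def)
  \<comment> \<open>The quotient has positive degree because \<open>|z| < |x|\<close>, so \<open>c t\<close> dominates \<open>y\<close>.\<close>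
  have "laurent_abs (x - (x - ?c * z)) = laurent_abs x"
    using c p by (intro laurent_abs_diff_eq_left) (simp add: euclid_pair_def)
  then have "laurent_abs z < laurent_abs ?c * laurent_abs z"
    using p by (simp add: euclid_pair_def laurent_abs_mult)
  then have "1 < laurent_abs ?c"
    using z by simp
  then have less: "laurent_abs t < laurent_abs (?c * t)"
    using t by (simp add: laurent_abs_mult)
  then have "laurent_abs (?c * t - y) = laurent_abs (?c * t)"
    using yt by (intro laurent_abs_diff_eq_left) simp
  then have "laurent_abs t \<le> laurent_abs (y - ?c * t)"
    using less laurent_abs_minus[of "y - ?c * t"] by simp
  with c show ?thesis
    by (rule that)
qed

text \<open>Induction on a bound for the exponent of \<open>|x| |y| / d\<close>. While the second
  components are out of order, a step replaces \<open>|x| |y|\<close> by \<open>|z| |t|\<close>,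
  which is smaller by at least a factor q.\<close>

lemma ex_ordered_euclid_pair:
  fixes x y z t :: "'a::{field,finite} fls"
  assumes M: "poly_submodule M" and d: "d > 0"
  shows "euclid_pair M d x y z t \<Longrightarrow> laurent_abs x * laurent_abs y \<le> real CARD('a) ^ n * d \<Longrightarrow>
    \<exists>x y z t. euclid_pair M d x y z t \<and> laurent_abs y \<le> laurent_abs t"
proof (induction n arbitrary: x y z t)
  case (0 x y z t)
  have "laurent_abs y \<le> laurent_abs t"
  \<comment> \<open>Otherwise \<open>|x t|\<close> and \<open>|y z|\<close> are both below
    \<open>|x| |y|\<close>, hence so is the determinant, although \<open>|x| |y|\<close> is at most
    \<open>d\<close>.\<close>
  proof (rule ccontr)
    assume "\<not> ?thesis"
    then have ty: "laurent_abs t < laurent_abs y"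
      by simp
    have zx: "laurent_abs z < laurent_abs x"
      using 0 by (simp add: euclid_pair_def)
    have "0 < laurent_abs x" "0 < laurent_abs y"
      using ty zx laurent_abs_nonneg le_less_trans by blast+
    then have "laurent_abs (x * t) < laurent_abs x * laurent_abs y"
      "laurent_abs (y * z) < laurent_abs x * laurent_abs y"
      using ty zx by (simp_all add: laurent_abs_mult mult.commute)
    then have "laurent_abs (x * t - y * z) < laurent_abs x * laurent_abs y"
      using laurent_abs_diff_le[of "x * t" "y * z"] by simp
    with 0 show False
      by (simp add: euclid_pair_def)
  qed
  with 0 show ?case
    by blast
next
  case (Suc n x y z t)
  note p = Suc.prems(1)
  show ?case
  proof (cases "z = 0")
    \<comment> \<open>The algorithm has stopped. As \<open>z = 0\<close>, reducing \<open>y\<close>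
      modulo \<open>t\<close> leaves \<open>x\<close> unchanged and gives the required order at
      once.\<close>
    case True
    then have "t \<noteq> 0"
      using p d by (auto simp: euclid_pair_def)
    then obtain c where c: "laurent_abs (y - fls_of_poly_T c * t) < laurent_abs t"
      by (rule ex_poly_quotient)
    have "(x - fls_of_poly_T c * z, y - fls_of_poly_T c * t) \<in> M"
      using M p by (auto simp: euclid_pair_def intro: poly_submoduleD)
    then have "euclid_pair M d x (y - fls_of_poly_T c * t) z t"
      using p True by (simp add: euclid_pair_def)
    with c show ?thesis
      using less_imp_le by blast
  next
    case z: False
    show ?thesis
    proof (cases "laurent_abs y \<le> laurent_abs t")
      case False
      let ?q = "real CARD('a)"
      obtain c where c: "euclid_pair M d z t (x - fls_of_poly_T c * z) (y - fls_of_poly_T c * t)"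
        using M p z by (rule euclid_pair_step)
      have "?q * laurent_abs z \<le> laurent_abs x"
        using p by (intro laurent_abs_discrete) (simp add: euclid_pair_def)
      then have "(?q * laurent_abs z) * laurent_abs t \<le> laurent_abs x * laurent_abs y"
        using False by (intro mult_mono) auto
      also have "\<dots> \<le> ?q * (?q ^ n * d)"
        using Suc.prems(2) by (simp add: mult.assoc)
      finally have "laurent_abs z * laurent_abs t \<le> ?q ^ n * d"
        using two_le_card_field[where 'a = 'a] by (simp add: mult.assoc)
      with c show ?thesis
        by (rule Suc.IH)
    qed (use p in blast)
  qed
qed

text \<open>The hypothesis on \<open>M\<close> keeps the algorithm from stopping. Each step divides
  the size of the first component by at least q and keeps the order, so \<open>n\<close> steps
  suffice.\<close>

lemma ex_small_ordered_euclid_pair: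
  fixes x y z t :: "'a::{field,finite} fls"
  assumes M: "poly_submodule M" and d: "d > 0"
    and nz: "\<And>z t. (z, t) \<in> M \<Longrightarrow> t \<noteq> 0 \<Longrightarrow> z \<noteq> 0"
  shows "euclid_pair M d x y z t \<Longrightarrow> laurent_abs y \<le> laurent_abs t \<Longrightarrow>
    laurent_abs x \<le> real CARD('a) ^ n * e \<Longrightarrow>
    \<exists>x y z t. euclid_pair M d x y z t \<and> laurent_abs y \<le> laurent_abs t \<and> laurent_abs x \<le> e"
proof (induction n arbitrary: x y z t)
  case 0
  then show ?case
    by auto
next
  case (Suc n x y z t)
  let ?q = "real CARD('a)"
  \<comment> \<open>The nonzero determinant excludes \<open>z = t = 0\<close>, and \<open>nz\<close>
    excludes \<open>z = 0\<close> with \<open>t\<close> nonzero.\<close>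
  have "z \<noteq> 0"
    using Suc.prems(1) d nz[of z t] by (auto simp: euclid_pair_def)
  then obtain z' t' where *: "euclid_pair M d z t z' t'" "laurent_abs t \<le> laurent_abs t'"
    using euclid_pair_ordered_step[OF M Suc.prems(1) _ Suc.prems(2) d] by blast
  have "?q * laurent_abs z \<le> laurent_abs x"
    using Suc.prems(1) by (intro laurent_abs_discrete) (simp add: euclid_pair_def)
  also have "\<dots> \<le> ?q * (?q ^ n * e)"
    using Suc.prems(3) by (simp add: mult.assoc)
  finally have "laurent_abs z \<le> ?q ^ n * e"
    using two_le_card_field[where 'a = 'a] by simp
  with * show ?case
    by (rule Suc.IH)
qed

section \<open>Rounding coordinates with respect to an ordered pair\<close>

lemma ex_inhomogeneous_approximation:
  fixes x y z t r s :: "'a::{field,finite} fls"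
  assumes M: "poly_submodule M" and d: "d > 0" and p: "euclid_pair M d x y z t"
    and yt: "laurent_abs y \<le> laurent_abs t"
  obtains u v where "(u, v) \<in> M"
    "laurent_abs (u + r) * laurent_abs (v + s) \<le> real CARD('a) powi (-2) * d"
    "laurent_abs (u + r) < laurent_abs x"
proof -
  let ?q = "real CARD('a)"
  have q: "1 < ?q"
    using two_le_card_field[where 'a = 'a] by simp
  define E where "E = x * t - y * z"
  have E: "E \<noteq> 0"
    using p d by (auto simp: euclid_pair_def E_def)
  have zx: "laurent_abs z < laurent_abs x"
    using p by (simp add: euclid_pair_def)
  have t: "0 < laurent_abs t"
    using E yt by (cases "t = 0") (auto simp: E_def)
  have "laurent_abs (y * z) \<le> laurent_abs t * laurent_abs z"
    unfolding laurent_abs_mult using yt by (intro mult_right_mono) auto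
  also have "\<dots> < laurent_abs (x * t)"
    using zx t by (simp add: laurent_abs_mult mult.commute)
  finally have "laurent_abs E = laurent_abs (x * t)"
    unfolding E_def by (rule laurent_abs_diff_eq_left)
  then have xt: "laurent_abs x * laurent_abs t = d"
    using p by (simp add: euclid_pair_def E_def laurent_abs_mult)
  \<comment> \<open>Cramer's rule for the coordinates of \<open>(r, s)\<close> in the basis
    \<open>(x, y)\<close>, \<open>(z, t)\<close>.\<close>
  define a where "a = (r * t - s * z) / E"
  define b where "b = (x * s - y * r) / E"
  have "a * x + b * z = r * E / E" "a * y + b * t = s * E / E"
    unfolding a_def b_def
    by (simp_all only: times_divide_eq_left flip: add_divide_distrib) (simp_all add: E_def algebra_simps)
  then have r: "r = a * x + b * z" and s: "s = a * y + b * t"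
    using E by simp_all
  obtain A where A: "laurent_abs (a - fls_of_poly_T A) \<le> 1 / ?q"
    by (rule ex_poly_part)
  obtain B where B: "laurent_abs (b - fls_of_poly_T B) \<le> 1 / ?q"
    by (rule ex_poly_part)
  \<comment> \<open>The vector sought is \<open>- A (x, y) - B (z, t)\<close>. Since
    \<open>poly_submodule\<close> only subtracts from a vector already in \<open>M\<close>, the
    start is \<open>(x, y)\<close>, and \<open>A + 1\<close> cancels it again.\<close>
  define u where "u = x - fls_of_poly_T (A + 1) * x - fls_of_poly_T B * z"
  define v where "v = y - fls_of_poly_T (A + 1) * y - fls_of_poly_T B * t"
  have uv: "(u, v) \<in> M"
    unfolding u_def v_def using p by (intro poly_submoduleD[OF M]) (auto simp: euclid_pair_def)
  have bound: "laurent_abs ((a - fls_of_poly_T A) * f + (b - fls_of_poly_T B) * g) \<le> m / ?q"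
    if "laurent_abs f \<le> m" "laurent_abs g \<le> m" for f g m
  proof -
    have "laurent_abs (a - fls_of_poly_T A) * laurent_abs f \<le> 1 / ?q * m"
      using A that by (intro mult_mono) auto
    moreover have "laurent_abs (b - fls_of_poly_T B) * laurent_abs g \<le> 1 / ?q * m"
      using B that by (intro mult_mono) auto
    ultimately show ?thesis
      using laurent_abs_add_le[of "(a - fls_of_poly_T A) * f" "(b - fls_of_poly_T B) * g"]
      by (simp add: laurent_abs_mult)
  qed
  have "u + r = (a - fls_of_poly_T A) * x + (b - fls_of_poly_T B) * z"
    by (simp add: u_def r fls_of_poly_T_add algebra_simps)
  then have ur: "laurent_abs (u + r) \<le> laurent_abs x / ?q"
    using bound[of x "laurent_abs x" z] zx by simp
  have "v + s = (a - fls_of_poly_T A) * y + (b - fls_of_poly_T B) * t"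
    by (simp add: v_def s fls_of_poly_T_add algebra_simps)
  then have vs: "laurent_abs (v + s) \<le> laurent_abs t / ?q"
    using bound[of y "laurent_abs t" t] yt by simp
  have "laurent_abs (u + r) * laurent_abs (v + s) \<le> (laurent_abs x / ?q) * (laurent_abs t / ?q)"
    using ur vs by (intro mult_mono) auto
  also have "\<dots> = ?q powi (-2) * d"
    by (simp add: power_int_minus field_simps power2_eq_square flip: xt)
  finally have prod: "laurent_abs (u + r) * laurent_abs (v + s) \<le> ?q powi (-2) * d" .
  have "0 < laurent_abs x"
    using zx laurent_abs_nonneg le_less_trans by blast
  then have "laurent_abs x / ?q < laurent_abs x"
    using q by (simp add: field_simps)
  with ur have "laurent_abs (u + r) < laurent_abs x"
    by simp
  with uv prod show ?thesis
    by (rule that)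
qed

section \<open>The module of values of the two linear forms\<close>

definition linear_forms_image ::
  "'a::comm_ring_1 fls \<Rightarrow> 'a fls \<Rightarrow> 'a fls \<Rightarrow> 'a fls \<Rightarrow> ('a fls \<times> 'a fls) set" where
  "linear_forms_image l1 k1 l2 k2 = range (\<lambda>Q. (linear_form_T l1 k1 Q, linear_form_T l2 k2 Q))"

lemma poly_submodule_linear_forms_image: "poly_submodule (linear_forms_image l1 k1 l2 k2)"
  unfolding poly_submodule_def
proof (intro allI impI)
  fix x y z t c
  assume "(x, y) \<in> linear_forms_image l1 k1 l2 k2" "(z, t) \<in> linear_forms_image l1 k1 l2 k2"
  then obtain P R where
    "x = linear_form_T l1 k1 P" "y = linear_form_T l2 k2 P"
    "z = linear_form_T l1 k1 R" "t = linear_form_T l2 k2 R"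
    by (auto simp: linear_forms_image_def)
  then show "(x - fls_of_poly_T c * z, y - fls_of_poly_T c * t) \<in> linear_forms_image l1 k1 l2 k2"
    unfolding linear_forms_image_def
    by (intro range_eqI[of _ _ "(fst P - c * fst R, snd P - c * snd R)"])
      (simp add: linear_form_T_def fls_of_poly_T_diff fls_of_poly_T_mult
        algebra_simps)
qed

lemma basis_in_linear_forms_image:
  "(l1, l2) \<in> linear_forms_image l1 k1 l2 k2" "(k1, k2) \<in> linear_forms_image l1 k1 l2 k2"
  unfolding linear_forms_image_def
  by (rule range_eqI[of _ _ "(1, 0)"], simp add: linear_form_T_def)
    (rule range_eqI[of _ _ "(0, 1)"], simp add: linear_form_T_def)

text \<open>The values at the unit vectors have the right determinant. If \<open>k1 = 0\<close>,
  their first components are already strictly decreasing; otherwise one division of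
  \<open>l1\<close> by \<open>k1\<close> makes them so.\<close>

lemma ex_euclid_pair_linear_forms_image:
  fixes l1 k1 l2 k2 :: "'a::{field,finite} fls"
  assumes "l1 * k2 - l2 * k1 \<noteq> 0"
  obtains x y z t where
    "euclid_pair (linear_forms_image l1 k1 l2 k2) (laurent_abs (l1 * k2 - l2 * k1)) x y z t"
proof (cases "k1 = 0")
  case True
  with assms have "euclid_pair (linear_forms_image l1 k1 l2 k2) (laurent_abs (l1 * k2 - l2 * k1)) l1 l2 k1 k2"
    using basis_in_linear_forms_image by (auto simp: euclid_pair_def)
  then show ?thesis
    by (rule that)
next
  case False
  then obtain c where c: "laurent_abs (l1 - fls_of_poly_T c * k1) < laurent_abs k1"
    by (rule ex_poly_quotient)
  have "k1 * (l2 - fls_of_poly_T c * k2) - k2 * (l1 - fls_of_poly_T c * k1) = - (l1 * k2 - l2 * k1)"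
    by (simp add: algebra_simps)
  then have "laurent_abs (k1 * (l2 - fls_of_poly_T c * k2) - k2 * (l1 - fls_of_poly_T c * k1)) =
      laurent_abs (l1 * k2 - l2 * k1)"
    by (simp only: laurent_abs_minus)
  with c show ?thesis
    by (intro that[of k1 k2 "l1 - fls_of_poly_T c * k1" "l2 - fls_of_poly_T c * k2"])
      (simp add: euclid_pair_def basis_in_linear_forms_image
        poly_submoduleD[OF poly_submodule_linear_forms_image])
qed

text \<open>A nontrivial zero has nonzero second entry, and solving for \<open>k / l\<close>
  exhibits it as a quotient of polynomials.\<close>

lemma linear_form_T_nonzero_if_irrational:
  fixes l k :: "'a::field fls"
  assumes irr: "k * inverse l \<notin> rational_functions_T" and Q: "Q \<noteq> (0, 0)"
  shows "linear_form_T l k Q \<noteq> 0"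
proof
  assume *: "linear_form_T l k Q = 0"
  have rat: "fls_of_poly_T A / fls_of_poly_T B \<in> rational_functions_T" if "B \<noteq> 0" for A B :: "'a poly"
    using that by (auto simp: rational_functions_T_def)
  \<comment> \<open>With \<open>inverse 0 = 0\<close>, a vanishing \<open>l\<close> would make
    \<open>k * inverse l\<close> equal to 0, which is rational.\<close>
  have l: "l \<noteq> 0"
    using irr rat[of 1 0] by auto
  have Q2: "snd Q \<noteq> 0"
    using * l Q by (cases Q) (auto simp: linear_form_T_def)
  have "k * fls_of_poly_T (snd Q) = - (l * fls_of_poly_T (fst Q))"
    using * by (simp add: linear_form_T_def eq_neg_iff_add_eq_0 add.commute)
  then have "k * inverse l = fls_of_poly_T (- fst Q) / fls_of_poly_T (snd Q)"
    using l Q2 by (simp add: fls_of_poly_T_uminus field_simps)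
  with irr rat[OF Q2] show False
    by simp
qed

theorem theorem3p3:
  fixes lam1 kap1 lam2 kap2 :: "'a::{field,finite} fls"
  assumes "laurent_abs (lam1 * kap2 - lam2 * kap1) > 0"
  shows "(\<forall>rho1 rho2 :: 'a fls. \<exists>Q :: 'a poly \<times> 'a poly.
            laurent_abs (linear_form_T lam1 kap1 Q + rho1) * laurent_abs (linear_form_T lam2 kap2 Q + rho2)
              \<le> real CARD('a) powi (-2) * laurent_abs (lam1 * kap2 - lam2 * kap1)) \<and>
         (kap1 * inverse lam1 \<notin> rational_functions_T \<longrightarrow>
          (\<forall>(rho1 :: 'a fls) (rho2 :: 'a fls) (k :: nat). \<exists>Q :: 'a poly \<times> 'a poly.
            laurent_abs (linear_form_T lam1 kap1 Q + rho1) * laurent_abs (linear_form_T lam2 kap2 Q + rho2)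
              \<le> real CARD('a) powi (-2) * laurent_abs (lam1 * kap2 - lam2 * kap1) \<and>
            laurent_deg (linear_form_T lam1 kap1 Q + rho1) < - ereal (real k)))"
proof -
  let ?q = "real CARD('a)"
  define d where "d = laurent_abs (lam1 * kap2 - lam2 * kap1)"
  define M where "M = linear_forms_image lam1 kap1 lam2 kap2"
  have d: "d > 0"
    using assms by (simp add: d_def)
  have q: "1 < ?q"
    using two_le_card_field[where 'a = 'a] by simp
  have M: "poly_submodule M"
    unfolding M_def by (rule poly_submodule_linear_forms_image)
  \<comment> \<open>Supplies the number of steps for both inductions, with \<open>e\<close> equal to
    \<open>d\<close> first and to the k-th negative power of q later.\<close>
  have ex_power: "\<exists>n. a \<le> ?q ^ n * e" if "e > 0" for a e
  proof -
    obtain n where "a / e < ?q ^ n"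
      using real_arch_pow[OF q] by blast
    with that show ?thesis
      by (intro exI[of _ n]) (simp add: field_simps)
  qed
  obtain x0 y0 z0 t0 where p0: "euclid_pair M d x0 y0 z0 t0"
    unfolding M_def d_def using assms by (auto intro: ex_euclid_pair_linear_forms_image)
  obtain n where "laurent_abs x0 * laurent_abs y0 \<le> ?q ^ n * d"
    using ex_power[OF d] by blast
  then obtain x y z t where p: "euclid_pair M d x y z t" "laurent_abs y \<le> laurent_abs t"
    using ex_ordered_euclid_pair[OF M d p0] by blast
  have "\<exists>Q. laurent_abs (linear_form_T lam1 kap1 Q + rho1) * laurent_abs (linear_form_T lam2 kap2 Q + rho2)
      \<le> ?q powi (-2) * d" for rho1 rho2
    by (rule ex_inhomogeneous_approximation[OF M d p, of rho1 rho2])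
      (auto simp: M_def linear_forms_image_def)
  moreover have "\<exists>Q. laurent_abs (linear_form_T lam1 kap1 Q + rho1) *
        laurent_abs (linear_form_T lam2 kap2 Q + rho2) \<le> ?q powi (-2) * d \<and>
      laurent_deg (linear_form_T lam1 kap1 Q + rho1) < - ereal (real k)"
    if irr: "kap1 * inverse lam1 \<notin> rational_functions_T" for rho1 rho2 k
  proof -
    have nz: "z \<noteq> 0" if zt: "(z, t) \<in> M" and "t \<noteq> 0" for z t
    proof -
      obtain Q where Q: "z = linear_form_T lam1 kap1 Q" "t = linear_form_T lam2 kap2 Q"
        using zt by (auto simp: M_def linear_forms_image_def)
      with \<open>t \<noteq> 0\<close> have "Q \<noteq> (0, 0)"
        by (auto simp: linear_form_T_def)
      with irr show ?thesis
        unfolding Q(1) by (rule linear_form_T_nonzero_if_irrational)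
    qed
    have "0 < ?q powi (- int k)"
      using q by simp
    then obtain n where n: "laurent_abs x \<le> ?q ^ n * ?q powi (- int k)"
      using ex_power by blast
    \<comment> \<open>The target size has exponent exactly \<open>- k\<close>: the later inequality
      \<open>|u + rho1| < |x'|\<close> is strict, so the degree falls strictly below
      \<open>- k\<close>.\<close>
    obtain x' y' z' t' where p': "euclid_pair M d x' y' z' t'" "laurent_abs y' \<le> laurent_abs t'"
      and x': "laurent_abs x' \<le> ?q powi (- int k)"
      using ex_small_ordered_euclid_pair[OF M d _ p n] nz by blast
    obtain u v where uv: "(u, v) \<in> M"
      "laurent_abs (u + rho1) * laurent_abs (v + rho2) \<le> ?q powi (-2) * d"
      "laurent_abs (u + rho1) < laurent_abs x'"
      using ex_inhomogeneous_approximation[OF M d p'] by blast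
    have "laurent_deg (u + rho1) < - ereal (real k)"
      using uv(3) x' by (intro laurent_deg_less_if_laurent_abs_less) simp
    with uv(1,2) show ?thesis
      by (auto simp: M_def linear_forms_image_def)
  qed
  ultimately show ?thesis
    unfolding d_def by blast
qed

end
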